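(* Let $f,g_1,\dots,g_l,h_1,\dots,h_m\in\mathbb{R}[x]$, $x=(x_1,\dots,x_n)$, let $S=\{x\in\mathbb{R}^n : g_i(x)=0\ (1\le i\le l),\ h_j(x)\ge 0\ (1\le j\le m)\}$, and let $x^*\in\Sigma(f,S)$ be a KKT point that is not an isolated point of $S$. Assume that (LICQ) holds at $x^*$. Suppose that $R>0$ is a faithful radius of $f$ on $S$ at $x^*$. Put $f_R^{\min}=\min\{f(x): x\in S\cap\mathbb{B}_R(x^* )\}$ and $f_R^{\max}=\max\{f(x): x\in S\cap\mathbb{B}_R(x^* )\}$. Then: (i) $x^*$ is a local minimizer of $f$ on $S$ if and only if $f_R^{\max}>f(x^* )=f_R^{\min}$; (ii) $x^*$ is a local maximizer of $f$ on $S$ if and only if $f_R^{\max}=f(x^* )>f_R^{\min}$; (iii) $x^*$ is not an extremum point of $f$ on $S$ if and only if $f_R^{\max}>f(x^* )>f_R^{\min}$.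
   Context: $\mathbb{B}_R(x^* )$ is the closed Euclidean ball with center $x^*$ and radius $R$. For $x\in S$, $J(x)=\{j: h_j(x)=0\}$; (LICQ) holds at $x\in S$ if the vectors $\nabla g_i(x)$ ($1\le i\le l$), $\nabla h_j(x)$ ($j\in J(x)$) are linearly independent. KKT points: $\Sigma(f,S)$ is the set of $x\in S$ for which there exist $\lambda_i,\nu_j\in\mathbb{R}$ (no sign condition) with $\nabla f(x)-\sum_{i=1}^l\lambda_i\nabla g_i(x)-\sum_{j=1}^m\nu_j\nabla h_j(x)=0$ and $\nu_jh_j(x)=0$ for all $j$. Tangency variety: $\Gamma(f,S,x^* )$ is the set of $x\in S$ for which there exist real numbers $\kappa,\lambda_i,\nu_j,\mu$, not all zero, with $\kappa\nabla f(x)-\sum_{i=1}^l\lambda_i\nabla g_i(x)-\sum_{j=1}^m\nu_j\nabla h_j(x)-\mu(x-x^* )=0$ and $\nu_jh_j(x)=0$ for all $j$. Faithful radius: $R>0$ is a faithful radius of $f$ on $S$ at $x^*$ if (i) $\Sigma(f,S)\cap\mathbb{B}_R(x^* )=\{x^*\}$; (ii) $\Gamma(f,S,x^* )\cap\mathbb{B}_R(x^* )$ is connected; (iii) $\Gamma(f,S,x^* )\cap\{x\in\mathbb{R}^n: f(x)=f(x^* )\}\cap\mathbb{B}_R(x^* )=\{x^*\}$. $x^*$ is a local minimizer (resp. maximizer) of $f$ on $S$ if there is an open neighborhood $U$ of $x^*$ with $f(x^* )\le f(x)$ (resp. $\ge$) for all $x\in S\cap U$. $x^*$ is not an extremum point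 of $f$ on $S$ if for every open neighborhood $U$ of $x^*$ there are $u,v\in S\cap U$ with $f(u)<f(x^* )<f(v)$. *)

theory Defs
  imports "HOL-Analysis.Analysis"
begin

text \<open>
  Real polynomials in \<open>n\<close> variables are represented by the polynomial functions on \<open>real ^ 'n\<close>
  (library predicate \<^const>\<open>real_polynomial_function\<close>). The constraints form families
  \<open>g 1, \<dots>, g l\<close> and \<open>h 1, \<dots>, h m\<close>; values outside these index ranges are never used, and
  \<open>l = 0\<close> or \<open>m = 0\<close> is allowed.
\<close>

definition gradient :: "(real ^ 'n \<Rightarrow> real) \<Rightarrow> real ^ 'n \<Rightarrow> real ^ 'n" where
  "gradient f x = (THE D. GDERIV f x :> D)"

lemma gradient_eqI:
  fixes f :: "real ^ 'n \<Rightarrow> real"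
  assumes "GDERIV f x :> D"
  shows "gradient f x = D"
  unfolding gradient_def
proof (rule the_equality)
  show "GDERIV f x :> D" by (fact assms)
next
  fix E assume "GDERIV f x :> E"
  then have "(\<lambda>h. h \<bullet> E) = (\<lambda>h. h \<bullet> D)"
    using assms unfolding gderiv_def by (rule has_derivative_unique)
  then have "\<forall>h. h \<bullet> E = h \<bullet> D"
    by (simp add: fun_eq_iff)
  then show "E = D"
    by (simp only: vector_eq_ldot)
qed

lemma GDERIV_gradient:
  fixes f :: "real ^ 'n \<Rightarrow> real"
  assumes "f differentiable (at x)"
  shows "GDERIV f x :> gradient f x"
proof -
  obtain f' where f': "(f has_derivative f') (at x)"
    using assms unfolding differentiable_def by blast
  have "linear f'"
    using f' by (rule has_derivative_linear)
  then have "f' = (\<lambda>h. h \<bullet> adjoint f' 1)"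
    using adjoint_works[of f' _ 1] by simp
  with f' have "GDERIV f x :> adjoint f' 1"
    unfolding gderiv_def by simp
  then show ?thesis
    by (simp only: gradient_eqI)
qed

definition feasible_set ::
  "nat \<Rightarrow> nat \<Rightarrow> (nat \<Rightarrow> real ^ 'n \<Rightarrow> real) \<Rightarrow> (nat \<Rightarrow> real ^ 'n \<Rightarrow> real) \<Rightarrow> (real ^ 'n) set" where
  "feasible_set l m g h = {x. (\<forall>i\<in>{1..l}. g i x = 0) \<and> (\<forall>j\<in>{1..m}. h j x \<ge> 0)}"

definition active_indices :: "nat \<Rightarrow> (nat \<Rightarrow> real ^ 'n \<Rightarrow> real) \<Rightarrow> real ^ 'n \<Rightarrow> nat set" where
  "active_indices m h x = {j\<in>{1..m}. h j x = 0}"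

text \<open>
  Linear independence of the gradients is independence of a family, so that repeated vectors
  count as dependent; hence the injectivity clause in addition to \<^const>\<open>independent\<close>, which is
  a predicate on sets.
\<close>

definition LICQ ::
  "nat \<Rightarrow> nat \<Rightarrow> (nat \<Rightarrow> real ^ 'n \<Rightarrow> real) \<Rightarrow> (nat \<Rightarrow> real ^ 'n \<Rightarrow> real) \<Rightarrow> real ^ 'n \<Rightarrow> bool" where
  "LICQ l m g h x \<longleftrightarrow>
     (let I = {1..l} <+> active_indices m h x;
          v = case_sum (\<lambda>i. gradient (g i) x) (\<lambda>j. gradient (h j) x)
      in inj_on v I \<and> independent (v ` I))"

text \<open>The multipliers carry no sign condition.\<close>

definition KKT_points ::
  "nat \<Rightarrow> nat \<Rightarrow> (real ^ 'n \<Rightarrow> real) \<Rightarrow> (nat \<Rightarrow> real ^ 'n \<Rightarrow> real) \<Rightarrow> (nat \<Rightarrow> real ^ 'n \<Rightarrow> real)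
    \<Rightarrow> (real ^ 'n) set" where
  "KKT_points l m f g h =
     {x \<in> feasible_set l m g h. \<exists>(\<alpha> :: nat \<Rightarrow> real) (\<nu> :: nat \<Rightarrow> real).
        gradient f x - (\<Sum>i=1..l. \<alpha> i *\<^sub>R gradient (g i) x)
          - (\<Sum>j=1..m. \<nu> j *\<^sub>R gradient (h j) x) = 0 \<and>
        (\<forall>j\<in>{1..m}. \<nu> j * h j x = 0)}"

definition tangency_variety ::
  "nat \<Rightarrow> nat \<Rightarrow> (real ^ 'n \<Rightarrow> real) \<Rightarrow> (nat \<Rightarrow> real ^ 'n \<Rightarrow> real) \<Rightarrow> (nat \<Rightarrow> real ^ 'n \<Rightarrow> real)
    \<Rightarrow> real ^ 'n \<Rightarrow> (real ^ 'n) set" where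
  "tangency_variety l m f g h x0 =
     {x \<in> feasible_set l m g h.
        \<exists>(\<kappa> :: real) (\<alpha> :: nat \<Rightarrow> real) (\<nu> :: nat \<Rightarrow> real) (\<mu> :: real).
        (\<kappa> \<noteq> 0 \<or> (\<exists>i\<in>{1..l}. \<alpha> i \<noteq> 0) \<or> (\<exists>j\<in>{1..m}. \<nu> j \<noteq> 0) \<or> \<mu> \<noteq> 0) \<and>
        \<kappa> *\<^sub>R gradient f x - (\<Sum>i=1..l. \<alpha> i *\<^sub>R gradient (g i) x)
          - (\<Sum>j=1..m. \<nu> j *\<^sub>R gradient (h j) x) - \<mu> *\<^sub>R (x - x0) = 0 \<and>
        (\<forall>j\<in>{1..m}. \<nu> j * h j x = 0)}"

definition faithful_radius ::
  "nat \<Rightarrow> nat \<Rightarrow> (real ^ 'n \<Rightarrow> real) \<Rightarrow> (nat \<Rightarrow> real ^ 'n \<Rightarrow> real) \<Rightarrow> (nat \<Rightarrow> real ^ 'n \<Rightarrow> real)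
    \<Rightarrow> real ^ 'n \<Rightarrow> real \<Rightarrow> bool" where
  "faithful_radius l m f g h x0 R \<longleftrightarrow>
     R > 0 \<and>
     KKT_points l m f g h \<inter> cball x0 R = {x0} \<and>
     connected (tangency_variety l m f g h x0 \<inter> cball x0 R) \<and>
     tangency_variety l m f g h x0 \<inter> {x. f x = f x0} \<inter> cball x0 R = {x0}"

definition local_minimizer_on ::
  "(real ^ 'n \<Rightarrow> real) \<Rightarrow> (real ^ 'n) set \<Rightarrow> real ^ 'n \<Rightarrow> bool" where
  "local_minimizer_on f S x0 \<longleftrightarrow>
     (\<exists>U. open U \<and> x0 \<in> U \<and> (\<forall>x \<in> S \<inter> U. f x0 \<le> f x))"

definition local_maximizer_on ::
  "(real ^ 'n \<Rightarrow> real) \<Rightarrow> (real ^ 'n) set \<Rightarrow> real ^ 'n \<Rightarrow> bool" where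
  "local_maximizer_on f S x0 \<longleftrightarrow>
     (\<exists>U. open U \<and> x0 \<in> U \<and> (\<forall>x \<in> S \<inter> U. f x0 \<ge> f x))"

definition not_extremum_on ::
  "(real ^ 'n \<Rightarrow> real) \<Rightarrow> (real ^ 'n) set \<Rightarrow> real ^ 'n \<Rightarrow> bool" where
  "not_extremum_on f S x0 \<longleftrightarrow>
     (\<forall>U. open U \<and> x0 \<in> U \<longrightarrow> (\<exists>u \<in> S \<inter> U. \<exists>v \<in> S \<inter> U. f u < f x0 \<and> f x0 < f v))"

text \<open>
  Minimum and maximum of \<open>f\<close> over a set (\<^const>\<open>Min\<close> and \<^const>\<open>Max\<close> are for finite sets only).
  They are meaningful when attained, which the lemmas below give for continuous functions on
  nonempty compact sets.
\<close>

definition min_value :: "(real ^ 'n \<Rightarrow> real) \<Rightarrow> (real ^ 'n) set \<Rightarrow> real" where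
  "min_value f A = (LEAST v. v \<in> f ` A)"

definition max_value :: "(real ^ 'n \<Rightarrow> real) \<Rightarrow> (real ^ 'n) set \<Rightarrow> real" where
  "max_value f A = (GREATEST v. v \<in> f ` A)"

lemma min_value_attained:
  fixes f :: "real ^ 'n \<Rightarrow> real"
  assumes "compact A" "A \<noteq> {}" "continuous_on A f"
  shows "min_value f A \<in> f ` A \<and> (\<forall>x\<in>A. min_value f A \<le> f x)"
proof -
  obtain a where a: "a \<in> A" "\<forall>x\<in>A. f a \<le> f x"
    using continuous_attains_inf[OF assms] by blast
  then have "min_value f A = f a"
    unfolding min_value_def by (intro Least_equality) auto
  with a show ?thesis by simp
qed

lemma max_value_attained:
  fixes f :: "real ^ 'n \<Rightarrow> real"
  assumes "compact A" "A \<noteq> {}" "continuous_on A f"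
  shows "max_value f A \<in> f ` A \<and> (\<forall>x\<in>A. f x \<le> max_value f A)"
proof -
  obtain a where a: "a \<in> A" "\<forall>x\<in>A. f x \<le> f a"
    using continuous_attains_sup[OF assms] by blast
  then have "max_value f A = f a"
    unfolding max_value_def by (intro Greatest_equality) auto
  with a show ?thesis by simp
qed

end

theory Submission
  imports Defs
begin

text \<open>
  By the Lagrange multiplier rule, the points where \<^term>\<open>f\<close> attains its minimum over the slice of
  the feasible set by a sphere around \<^term>\<open>x0\<close> lie in the tangency variety. If \<^term>\<open>x0\<close> is a local
  minimizer, then connectedness of the variety within the ball, together with
  \<^term>\<open>f x \<noteq> f x0\<close> on it away from \<^term>\<open>x0\<close>, forces \<^term>\<open>f x > f x0\<close> there, hence on every
  slice and so on all feasible points of the ball other than \<^term>\<open>x0\<close>. Maximizers are handled by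
  passing to \<open>-f\<close>.
\<close>

section \<open>Lagrange multiplier rule from an open mapping argument\<close>

text \<open>
  Completing the independent set of gradients to a basis turns the functions into the
  coordinates of a map of the space to itself with invertible derivative, which is open at
  \<^term>\<open>x\<close>.
\<close>

lemma independent_family_regular_value:
  fixes \<phi> :: "real ^ 'n \<Rightarrow> real ^ 'n \<Rightarrow> real" and x :: "real ^ 'n"
  assumes ind: "independent B" and "a \<in> B" and U: "open U" "x \<in> U"
    and der: "\<And>b. b \<in> B \<Longrightarrow> GDERIV (\<phi> b) x :> b"
    and cont: "\<And>b. b \<in> B \<Longrightarrow> continuous_on UNIV (\<phi> b)"
  shows "\<exists>e>0. \<forall>t. \<bar>t\<bar> < e \<longrightarrow> (\<exists>y\<in>U. \<phi> a y = \<phi> a x + t \<and> (\<forall>b\<in>B-{a}. \<phi> b y = \<phi> b x))"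
proof -
  define C where "C = extend_basis B"
  have BC: "B \<subseteq> C" and indC: "independent C" and spanC: "span C = UNIV"
    using extend_basis_superset[OF ind] independent_extend_basis[OF ind] span_extend_basis[OF ind]
    by (auto simp: C_def)
  have finC: "finite C" using indC by (rule independent_imp_finite)
  \<comment> \<open>A basis vector \<open>b\<close> added to \<open>B\<close> has no function
    attached. The linear functional with gradient \<open>b\<close> fills the gap, so every
    coordinate of \<open>F\<close> has its own basis vector as gradient at \<open>x\<close>.\<close>
  define \<psi> where "\<psi> b = (if b \<in> B then \<phi> b else (\<lambda>y. y \<bullet> b))" for b
  have der\<psi>: "(\<psi> b has_derivative (\<lambda>h. h \<bullet> b)) (at x)" for b
    using der[of b] by (auto simp: \<psi>_def gderiv_def intro!: derivative_eq_intros)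
  have cont\<psi>: "continuous_on UNIV (\<psi> b)" for b
    using cont[of b] by (auto simp: \<psi>_def intro!: continuous_intros)
  define F where "F y = (\<Sum>b\<in>C. \<psi> b y *\<^sub>R b)" for y
  define D where "D h = (\<Sum>b\<in>C. (h \<bullet> b) *\<^sub>R b)" for h :: "real ^ 'n"
  have derF: "(F has_derivative D) (at x)"
    unfolding F_def D_def by (intro has_derivative_sum has_derivative_scaleR_left der\<psi>)
  have contF: "continuous_on UNIV F"
    unfolding F_def by (intro continuous_intros cont\<psi>)
  have linD: "linear D" using derF by (rule has_derivative_linear)
  \<comment> \<open>Pairing \<open>D h\<close> with \<open>h\<close> gives a sum of squares of
    \<open>h \<bullet> b\<close>, so a kernel vector is orthogonal to the spanning set
    \<open>C\<close>, hence to itself.\<close>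
  have "inj D"
    unfolding linear_injective_0[OF linD]
  proof (intro allI impI)
    fix h assume "D h = 0"
    then have "0 = h \<bullet> D h" by simp
    also have "\<dots> = (\<Sum>b\<in>C. (h \<bullet> b)\<^sup>2)"
      by (simp add: D_def inner_sum_right power2_eq_square)
    finally have "\<forall>b\<in>C. (h \<bullet> b)\<^sup>2 = 0"
      using sum_nonneg_eq_0_iff[OF finC, of "\<lambda>b. (h \<bullet> b)\<^sup>2"] by simp
    then have "orthogonal h b" if "b \<in> C" for b
      using that by (simp add: orthogonal_def)
    moreover have "h \<in> span C" using spanC by simp
    ultimately have "orthogonal h h" using orthogonal_to_span by blast
    then show "h = 0" by (simp add: orthogonal_self)
  qed
  then obtain D' where D': "linear D'" "D \<circ> D' = id"
    using linear_injective_isomorphism[OF linD] by (auto simp: fun_eq_iff)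
  \<comment> \<open>This open mapping theorem asks for a derivative at the single point
    \<open>x\<close> only, with \<open>D'\<close> as right inverse.\<close>
  have "F x \<in> interior (F ` U)"
    using sussmann_open_mapping[OF open_UNIV contF UNIV_I derF _ D'(2), of U] D'(1) U
    by (simp add: linear_conv_bounded_linear interior_open)
  then obtain d where "d > 0" and d: "ball (F x) d \<subseteq> F ` U"
    by (auto simp: mem_interior)
  have "a \<noteq> 0" using ind \<open>a \<in> B\<close> dependent_zero by blast
  show ?thesis
  \<comment> \<open>The target \<open>F x + t *\<^sub>R a\<close> has distance
    \<open>\<bar>t\<bar> * norm a\<close> from \<open>F x\<close>. Comparing coefficients in the
    basis \<open>C\<close> then shows that only the coordinate of \<open>a\<close> changes, by
    \<open>t\<close>.\<close>
  proof (intro exI[of _ "d / norm a"] conjI allI impI)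
    show "d / norm a > 0" using \<open>d > 0\<close> \<open>a \<noteq> 0\<close> by simp
    fix t :: real assume "\<bar>t\<bar> < d / norm a"
    then have "F x + t *\<^sub>R a \<in> ball (F x) d"
      using \<open>a \<noteq> 0\<close> by (simp add: dist_norm field_simps)
    with d obtain y where "y \<in> U" and y: "F x + t *\<^sub>R a = F y" by blast
    have "a \<in> C" using \<open>a \<in> B\<close> BC by blast
    then have "t *\<^sub>R a = (\<Sum>b\<in>C. (if b = a then t else 0) *\<^sub>R b)"
      using finC by (simp add: if_distrib[of "\<lambda>c. c *\<^sub>R _"] cong: if_cong)
    with y have "(\<Sum>b\<in>C. (\<psi> b x + (if b = a then t else 0) - \<psi> b y) *\<^sub>R b) = 0"
      by (simp add: F_def algebra_simps sum.distrib sum_subtractf)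
    then have eq: "\<psi> b x + (if b = a then t else 0) - \<psi> b y = 0" if "b \<in> C" for b
      using independentD[OF indC finC subset_refl,
          where u = "\<lambda>b. \<psi> b x + (if b = a then t else 0) - \<psi> b y"] that by blast
    show "\<exists>y\<in>U. \<phi> a y = \<phi> a x + t \<and> (\<forall>b\<in>B-{a}. \<phi> b y = \<phi> b x)"
    proof (intro bexI[of _ y] conjI ballI)
      show "\<phi> a y = \<phi> a x + t"
        using eq[OF \<open>a \<in> C\<close>] \<open>a \<in> B\<close> by (simp add: \<psi>_def)
      fix b assume "b \<in> B - {a}"
      then show "\<phi> b y = \<phi> b x"
        using eq[of b] BC by (auto simp: \<psi>_def)
    qed fact
  qed
qed

text \<open>Were the family independent, \<open>\<phi> a\<close> could be both raised and lowered
  inside \<open>U\<close> with the other functions held fixed, which excludes either kind of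
  extremum. Coefficients are indexed by \<open>K\<close>, so coinciding gradients count as
  dependent.\<close>

lemma extremum_imp_dependent_gradients:
  fixes \<phi> :: "'i \<Rightarrow> real ^ 'n \<Rightarrow> real" and x :: "real ^ 'n"
  assumes "finite K" and "a \<in> K" and U: "open U" "x \<in> U"
    and der: "\<And>k. k \<in> K \<Longrightarrow> GDERIV (\<phi> k) x :> v k"
    and cont: "\<And>k. k \<in> K \<Longrightarrow> continuous_on UNIV (\<phi> k)"
    and ext: "(\<forall>y\<in>U. (\<forall>k\<in>K-{a}. \<phi> k y = \<phi> k x) \<longrightarrow> \<phi> a x \<le> \<phi> a y) \<or>
              (\<forall>y\<in>U. (\<forall>k\<in>K-{a}. \<phi> k y = \<phi> k x) \<longrightarrow> \<phi> a y \<le> \<phi> a x)"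
  shows "\<exists>c. (\<exists>k\<in>K. c k \<noteq> 0) \<and> (\<Sum>k\<in>K. c k *\<^sub>R v k) = 0"
proof (rule ccontr)
  assume "\<not> ?thesis"
  then have none: "c k = 0" if "(\<Sum>k\<in>K. c k *\<^sub>R v k) = 0" "k \<in> K" for c k
    using that by blast
  have inj: "inj_on v K"
  proof (rule inj_onI, rule ccontr)
    fix i j assume ij: "i \<in> K" "j \<in> K" "v i = v j" "i \<noteq> j"
    have "(\<Sum>k\<in>K. ((if k = i then 1 else 0) - (if k = j then 1 else 0)) *\<^sub>R v k)
        = (\<Sum>k\<in>K. (if k = i then v k else 0)) - (\<Sum>k\<in>K. (if k = j then v k else 0))"
      unfolding sum_subtractf[symmetric] by (rule sum.cong) auto
    also have "\<dots> = 0" using \<open>finite K\<close> ij by simp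
    finally show False using none[of _ i] ij by fastforce
  qed
  have ind: "independent (v ` K)"
  proof
    assume "dependent (v ` K)"
    then obtain u k where "k \<in> K" "u (v k) \<noteq> 0" and "(\<Sum>w\<in>v ` K. u w *\<^sub>R w) = 0"
      using dependent_finite[of "v ` K"] \<open>finite K\<close> by auto
    then show False
      using none[of "u \<circ> v" k] inj by (simp add: sum.reindex)
  qed
  \<comment> \<open>The regular value lemma indexes functions by their gradients; injectivity of
    \<open>v\<close> on \<open>K\<close> makes this relabelling faithful.\<close>
  define \<psi> where "\<psi> b = \<phi> (the_inv_into K v b)" for b
  have \<psi>: "\<psi> (v k) = \<phi> k" if "k \<in> K" for k
    using that inj by (simp add: \<psi>_def the_inv_into_f_f)
  have "\<exists>e>0. \<forall>t. \<bar>t\<bar> < e \<longrightarrow>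
      (\<exists>y\<in>U. \<psi> (v a) y = \<psi> (v a) x + t \<and> (\<forall>b\<in>v ` K - {v a}. \<psi> b y = \<psi> b x))"
    using \<open>a \<in> K\<close> der cont by (intro independent_family_regular_value[OF ind _ U]) (auto simp: \<psi>)
  then obtain e where "e > 0" and e: "\<And>t. \<bar>t\<bar> < e \<Longrightarrow>
      \<exists>y\<in>U. \<psi> (v a) y = \<psi> (v a) x + t \<and> (\<forall>b\<in>v ` K - {v a}. \<psi> b y = \<psi> b x)"
    by blast
  have move: "\<exists>y\<in>U. \<phi> a y = \<phi> a x + t \<and> (\<forall>k\<in>K-{a}. \<phi> k y = \<phi> k x)" if "\<bar>t\<bar> < e" for t
  proof -
    from e[OF that] obtain y where "y \<in> U" "\<psi> (v a) y = \<psi> (v a) x + t"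
      and y: "\<forall>b\<in>v ` K - {v a}. \<psi> b y = \<psi> b x"
      by blast
    moreover have "\<phi> k y = \<phi> k x" if "k \<in> K - {a}" for k
    proof -
      have "v k \<in> v ` K - {v a}"
        using that \<open>a \<in> K\<close> inj by (auto dest: inj_onD)
      with y have "\<psi> (v k) y = \<psi> (v k) x" by blast
      then show ?thesis using that by (simp add: \<psi>)
    qed
    ultimately show ?thesis using \<open>a \<in> K\<close> by (auto simp: \<psi>)
  qed
  show False
    using ext move[of "e / 2"] move[of "- e / 2"] \<open>e > 0\<close> by fastforce
qed

section \<open>Extrema on spherical slices and the tangency variety\<close>

lemma real_polynomial_function_GDERIV:
  fixes p :: "real ^ 'n \<Rightarrow> real"
  assumes "real_polynomial_function p"
  shows "GDERIV p x :> gradient p x"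
  by (intro GDERIV_gradient differentiable_at_real_polynomial_function assms)

lemma real_polynomial_function_continuous_on:
  fixes p :: "real ^ 'n \<Rightarrow> real"
  assumes "real_polynomial_function p"
  shows "continuous_on A p"
  by (intro differentiable_imp_continuous_on differentiable_on_real_polynomial_function assms)

text \<open>
  The multipliers in the tangency variety carry no sign condition, so the active inequality
  constraints may be treated as equations.
\<close>

lemma sphere_extremum_in_tangency_variety:
  fixes f :: "real ^ 'n \<Rightarrow> real" and g h :: "nat \<Rightarrow> real ^ 'n \<Rightarrow> real"
  assumes f: "real_polynomial_function f"
    and g: "\<And>i. i \<in> {1..l} \<Longrightarrow> real_polynomial_function (g i)"
    and h: "\<And>j. j \<in> {1..m} \<Longrightarrow> real_polynomial_function (h j)"
    and x: "x \<in> feasible_set l m g h \<inter> sphere x0 r"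
    and ext: "(\<forall>y\<in>feasible_set l m g h \<inter> sphere x0 r. f x \<le> f y) \<or>
              (\<forall>y\<in>feasible_set l m g h \<inter> sphere x0 r. f y \<le> f x)"
  shows "x \<in> tangency_variety l m f g h x0"
proof -
  define J where "J = active_indices m h x"
  have J: "J \<subseteq> {1..m}" "finite J" by (auto simp: J_def active_indices_def)
  have hJ: "real_polynomial_function (h j)" if "j \<in> J" for j
    using that J by (intro h) auto
  \<comment> \<open>\<open>Inl True\<close> labels the objective \<open>f\<close> and
    \<open>Inl False\<close> the sphere constraint \<open>q\<close>; the remaining summands label
    the equations and the active inequalities.\<close>
  define K :: "(bool + nat + nat) set" where "K = UNIV <+> ({1..l} <+> J)"
  have mem_K: "Inl b \<in> K" "Inr (Inl i) \<in> K \<longleftrightarrow> i \<in> {1..l}" "Inr (Inr j) \<in> K \<longleftrightarrow> j \<in> J" for b i j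
    by (auto simp: K_def)
  \<comment> \<open>Half the squared distance has gradient exactly \<open>x - x0\<close>, the vector
    that \<open>\<mu>\<close> multiplies in the tangency variety.\<close>
  define q where "q y = (y - x0) \<bullet> (y - x0) / 2" for y
  define \<phi> where "\<phi> = case_sum (\<lambda>b. if b then f else q) (case_sum g h)"
  define v where "v = case_sum (\<lambda>b. if b then gradient f x else x - x0)
    (case_sum (\<lambda>i. gradient (g i) x) (\<lambda>j. gradient (h j) x))"
  \<comment> \<open>Inactive inequalities are strict at \<open>x\<close>; on this open set they stay
    strict and impose no further condition.\<close>
  define U where "U = (\<Inter>j\<in>{1..m}-J. {y. 0 < h j y})"
  have "open U"
    unfolding U_def using h
    by (intro open_INT ballI open_Collect_less continuous_intros
        real_polynomial_function_continuous_on) auto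
  have "x \<in> U"
    using x by (auto simp: U_def J_def active_indices_def feasible_set_def less_le)
  have q: "q y = (dist x0 y)\<^sup>2 / 2" for y
    by (simp only: q_def dist_norm power2_norm_eq_inner[symmetric] norm_minus_commute)
  have feas: "y \<in> feasible_set l m g h \<inter> sphere x0 r"
    if "y \<in> U" and eq: "\<forall>k\<in>K - {Inl True}. \<phi> k y = \<phi> k x" for y
  proof -
    have "q y = q x" using eq[rule_format, of "Inl False"] by (simp add: mem_K \<phi>_def)
    then have "y \<in> sphere x0 r" using x by (simp add: q)
    moreover have "g i y = 0" if "i \<in> {1..l}" for i
      using eq[rule_format, of "Inr (Inl i)"] that x by (simp add: mem_K \<phi>_def feasible_set_def)
    moreover have "h j y \<ge> 0" if "j \<in> {1..m}" for j
    proof (cases "j \<in> J")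
      case True
      then have "h j y = h j x"
        using eq[rule_format, of "Inr (Inr j)"] by (simp add: mem_K \<phi>_def)
      then show ?thesis using x that by (simp add: feasible_set_def)
    next
      case False
      then show ?thesis using \<open>y \<in> U\<close> that by (auto simp: U_def intro: less_imp_le)
    qed
    ultimately show ?thesis by (simp add: feasible_set_def)
  qed
  have "\<exists>c. (\<exists>k\<in>K. c k \<noteq> 0) \<and> (\<Sum>k\<in>K. c k *\<^sub>R v k) = 0"
  proof (rule extremum_imp_dependent_gradients[OF _ _ \<open>open U\<close> \<open>x \<in> U\<close>])
    show "finite K" "Inl True \<in> K" using J by (auto simp: K_def)
    have "GDERIV q x :> x - x0"
      unfolding q_def gderiv_def
      by (auto intro!: derivative_eq_intros simp: fun_eq_iff inner_commute field_simps)
    then show "GDERIV (\<phi> k) x :> v k" if "k \<in> K" for k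
      using that f g hJ
      by (auto simp: K_def \<phi>_def v_def intro!: real_polynomial_function_GDERIV)
    have "continuous_on UNIV q"
      unfolding q_def by (intro continuous_intros) auto
    then show "continuous_on UNIV (\<phi> k)" if "k \<in> K" for k
      using that f g hJ
      by (auto simp: K_def \<phi>_def intro: real_polynomial_function_continuous_on)
    show "(\<forall>y\<in>U. (\<forall>k\<in>K-{Inl True}. \<phi> k y = \<phi> k x) \<longrightarrow> \<phi> (Inl True) x \<le> \<phi> (Inl True) y) \<or>
          (\<forall>y\<in>U. (\<forall>k\<in>K-{Inl True}. \<phi> k y = \<phi> k x) \<longrightarrow> \<phi> (Inl True) y \<le> \<phi> (Inl True) x)"
      using ext feas unfolding \<phi>_def by (simp only: sum.case if_True) blast
  qed
  then obtain c k where "k \<in> K" "c k \<noteq> 0" and c: "(\<Sum>k\<in>K. c k *\<^sub>R v k) = 0" by blast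
  \<comment> \<open>The sign matches the subtraction in the tangency variety, and extension by zero
    off \<open>J\<close> yields complementarity.\<close>
  define \<nu> where "\<nu> j = (if j \<in> J then - c (Inr (Inr j)) else 0)" for j
  have "(\<Sum>j=1..m. \<nu> j *\<^sub>R gradient (h j) x) = (\<Sum>j\<in>J. \<nu> j *\<^sub>R gradient (h j) x)"
    using J by (intro sum.mono_neutral_right) (auto simp: \<nu>_def)
  also have "\<dots> = - (\<Sum>j\<in>J. c (Inr (Inr j)) *\<^sub>R gradient (h j) x)"
    by (simp add: \<nu>_def sum_negf)
  finally have "c (Inl True) *\<^sub>R gradient f x
      - (\<Sum>i=1..l. (- c (Inr (Inl i))) *\<^sub>R gradient (g i) x)
      - (\<Sum>j=1..m. \<nu> j *\<^sub>R gradient (h j) x) - (- c (Inl False)) *\<^sub>R (x - x0) = 0"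
    using c J by (simp add: K_def v_def sum.Plus UNIV_bool sum_negf algebra_simps)
  moreover have "\<forall>j\<in>{1..m}. \<nu> j * h j x = 0"
    by (auto simp: \<nu>_def J_def active_indices_def)
  moreover have "c (Inl True) \<noteq> 0 \<or> (\<exists>i\<in>{1..l}. - c (Inr (Inl i)) \<noteq> 0) \<or>
      (\<exists>j\<in>{1..m}. \<nu> j \<noteq> 0) \<or> - c (Inl False) \<noteq> 0"
  proof -
    consider (t) "k = Inl True" | (f) "k = Inl False" | (i) i where "i \<in> {1..l}" "k = Inr (Inl i)"
      | (j) j where "j \<in> J" "k = Inr (Inr j)"
      using \<open>k \<in> K\<close> by (auto simp: K_def)
    then show ?thesis
    proof cases
      case (j j)
      then have "j \<in> {1..m}" "\<nu> j \<noteq> 0"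
        using J \<open>c k \<noteq> 0\<close> by (auto simp: \<nu>_def)
      then show ?thesis by blast
    qed (use \<open>c k \<noteq> 0\<close> in auto)
  qed
  moreover have "x \<in> feasible_set l m g h" using x by blast
  ultimately show ?thesis
    unfolding tangency_variety_def
    by (intro CollectI conjI exI[of _ "c (Inl True)"] exI[of _ "\<lambda>i. - c (Inr (Inl i))"]
        exI[of _ \<nu>] exI[of _ "- c (Inl False)"])
qed

section \<open>Connectedness and strict minimality on the ball\<close>

text \<open>
  Since \<^term>\<open>x0\<close> is the only point of \<^term>\<open>T\<close> on its level, the part of \<^term>\<open>T\<close> below that
  level is open and, at a local minimizer, also closed in \<^term>\<open>T\<close>.
\<close>

lemma local_minimizer_strict_on_cball:
  fixes f :: "real ^ 'n \<Rightarrow> real"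
  assumes "closed S" and cont: "continuous_on UNIV f"
    and T: "connected T" "x0 \<in> T" "T \<subseteq> S" and level: "\<And>y. y \<in> T \<Longrightarrow> f y = f x0 \<Longrightarrow> y = x0"
    and sph: "\<And>r y. r \<le> R \<Longrightarrow> y \<in> S \<inter> sphere x0 r \<Longrightarrow>
        \<forall>z\<in>S \<inter> sphere x0 r. f y \<le> f z \<Longrightarrow> y \<in> T"
    and min: "local_minimizer_on f S x0"
    and x: "x \<in> S" "x \<in> cball x0 R" "x \<noteq> x0"
  shows "f x0 < f x"
proof -
  obtain U where U: "open U" "x0 \<in> U" "\<forall>y\<in>S \<inter> U. f x0 \<le> f y"
    using min unfolding local_minimizer_on_def by blast
  \<comment> \<open>Joining \<open>U\<close> to the superlevel set covers \<open>x0\<close>, the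
    only point of \<open>T\<close> on its level; local minimality keeps \<open>U \<inter> T\<close>
    out of \<open>?A\<close>.\<close>
  let ?A = "{y. f y < f x0}" and ?B = "{y. f x0 < f y} \<union> U"
  have "open ?A" "open ?B"
    using cont U(1) by (auto intro!: open_Collect_less continuous_intros)
  moreover have "T \<subseteq> ?A \<union> ?B"
    using level U(2) by (force simp: not_less_iff_gr_or_eq)
  moreover have "?A \<inter> ?B \<inter> T = {}"
    using U(3) T(3) by force
  moreover have "?B \<inter> T \<noteq> {}" using T(2) U(2) by blast
  ultimately have "?A \<inter> T = {}"
    using connectedD[OF T(1)] by blast
  \<comment> \<open>The slice through \<open>x\<close> itself is used: its minimizer
    \<open>y\<close> lies in \<open>T\<close>, and \<open>f y\<close> bounds \<open>f x\<close> from
    below.\<close>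
  define r where "r = dist x0 x"
  have "r > 0" "r \<le> R" using x by (auto simp: r_def)
  have "x \<in> S \<inter> sphere x0 r" using x by (simp add: r_def)
  moreover have "compact (S \<inter> sphere x0 r)" using \<open>closed S\<close> by (simp add: closed_Int_compact)
  ultimately obtain y where y: "y \<in> S \<inter> sphere x0 r" "\<forall>z\<in>S \<inter> sphere x0 r. f y \<le> f z"
    using continuous_attains_inf[of "S \<inter> sphere x0 r" f] continuous_on_subset[OF cont] by blast
  then have "y \<in> T" using sph \<open>r \<le> R\<close> by blast
  moreover have "y \<noteq> x0" using y(1) \<open>r > 0\<close> by auto
  ultimately have "f x0 < f y"
    using level \<open>?A \<inter> T = {}\<close> by (force simp: not_less_iff_gr_or_eq)
  also have "f y \<le> f x" using y(2) \<open>x \<in> S \<inter> sphere x0 r\<close> by blast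
  finally show ?thesis .
qed

lemma closed_feasible_set:
  assumes "\<And>i. i \<in> {1..l} \<Longrightarrow> continuous_on UNIV (g i)"
    and "\<And>j. j \<in> {1..m} \<Longrightarrow> continuous_on UNIV (h j)"
  shows "closed (feasible_set l m g h)"
proof -
  have "feasible_set l m g h = (\<Inter>i\<in>{1..l}. {x. g i x = 0}) \<inter> (\<Inter>j\<in>{1..m}. {x. 0 \<le> h j x})"
    by (auto simp: feasible_set_def)
  also have "closed \<dots>"
    using assms
    by (intro closed_Int closed_INT ballI closed_Collect_eq closed_Collect_le continuous_intros) auto
  finally show ?thesis .
qed

section \<open>Local extremality read off from the extreme values on the ball\<close>

theorem theorem4p4:
  fixes f :: "real ^ 'n \<Rightarrow> real"
    and g h :: "nat \<Rightarrow> real ^ 'n \<Rightarrow> real"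
    and l m :: nat
    and S :: "(real ^ 'n) set"
    and x0 :: "real ^ 'n"
    and R :: real
  assumes "real_polynomial_function f"
    and "\<And>i. i \<in> {1..l} \<Longrightarrow> real_polynomial_function (g i)"
    and "\<And>j. j \<in> {1..m} \<Longrightarrow> real_polynomial_function (h j)"
    and "S = feasible_set l m g h"
    and "x0 \<in> KKT_points l m f g h"
    and "\<not> x0 isolated_in S"
    and "LICQ l m g h x0"
    and "faithful_radius l m f g h x0 R"
  shows "(local_minimizer_on f S x0 \<longleftrightarrow>
            max_value f (S \<inter> cball x0 R) > f x0 \<and> f x0 = min_value f (S \<inter> cball x0 R)) \<and>
         (local_maximizer_on f S x0 \<longleftrightarrow>
            max_value f (S \<inter> cball x0 R) = f x0 \<and> f x0 > min_value f (S \<inter> cball x0 R)) \<and>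
         (not_extremum_on f S x0 \<longleftrightarrow>
            max_value f (S \<inter> cball x0 R) > f x0 \<and> f x0 > min_value f (S \<inter> cball x0 R))"
proof -
  let ?S = "S \<inter> cball x0 R"
  define T where "T = tangency_variety l m f g h x0 \<inter> cball x0 R"
  note S = assms(4)
  have contf: "continuous_on A f" for A
    using assms(1) by (rule real_polynomial_function_continuous_on)
  have "closed S"
    unfolding S using assms(2,3) by (intro closed_feasible_set real_polynomial_function_continuous_on)
  have "R > 0" and "connected T" and level: "T \<inter> {x. f x = f x0} = {x0}"
    using assms(8) by (auto simp: faithful_radius_def T_def Int_ac)
  have "x0 \<in> T" using level by blast
  have "T \<subseteq> S" by (auto simp: T_def S tangency_variety_def)
  have "x0 \<in> ?S" using \<open>x0 \<in> T\<close> \<open>T \<subseteq> S\<close> \<open>R > 0\<close> by auto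
  have crit: "y \<in> T" if "r \<le> R" "y \<in> S \<inter> sphere x0 r"
      "(\<forall>z\<in>S \<inter> sphere x0 r. f y \<le> f z) \<or> (\<forall>z\<in>S \<inter> sphere x0 r. f z \<le> f y)" for r y
    using sphere_extremum_in_tangency_variety[OF assms(1-3)] that by (auto simp: S T_def)
  have locmin: "f x0 < f x" if "local_minimizer_on f S x0" "x \<in> ?S" "x \<noteq> x0" for x
  proof (rule local_minimizer_strict_on_cball[OF \<open>closed S\<close> contf \<open>connected T\<close> \<open>x0 \<in> T\<close> \<open>T \<subseteq> S\<close>])
    show "y = x0" if "y \<in> T" "f y = f x0" for y using that level by blast
  qed (use crit that in auto)
  have locmax: "f x < f x0" if "local_maximizer_on f S x0" "x \<in> ?S" "x \<noteq> x0" for x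
  proof -
    \<comment> \<open>\<open>T\<close> remains the tangency variety of \<open>f\<close>: a minimum
      of \<open>-f\<close> on a slice is a maximum of \<open>f\<close>, which \<open>crit\<close>
      also places in \<open>T\<close>.\<close>
    have "- f x0 < - f x"
    proof (rule local_minimizer_strict_on_cball[OF \<open>closed S\<close> _ \<open>connected T\<close> \<open>x0 \<in> T\<close> \<open>T \<subseteq> S\<close>])
      show "continuous_on UNIV (\<lambda>x. - f x)" by (intro continuous_intros contf)
      show "y = x0" if "y \<in> T" "- f y = - f x0" for y using that level by auto
      show "local_minimizer_on (\<lambda>x. - f x) S x0"
        using that(1) by (simp add: local_minimizer_on_def local_maximizer_on_def)
    qed (use crit that in auto)
    then show ?thesis by simp
  qed
  \<comment> \<open>Non-isolation supplies a second feasible point in the ball. Strictness of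
    \<open>locmin\<close> or \<open>locmax\<close> at \<open>p\<close> separates the opposite
    extreme value from \<open>f x0\<close>.\<close>
  obtain p where p: "p \<in> ?S" "p \<noteq> x0"
    using assms(6) \<open>R > 0\<close> \<open>x0 \<in> ?S\<close> unfolding isolated_in_dist_Ex_iff
    by (metis IntD1 IntI less_imp_le mem_cball)
  have "compact ?S" using \<open>closed S\<close> by (simp add: closed_Int_compact)
  then have mn: "min_value f ?S \<in> f ` ?S" "\<And>x. x \<in> ?S \<Longrightarrow> min_value f ?S \<le> f x"
    and mx: "max_value f ?S \<in> f ` ?S" "\<And>x. x \<in> ?S \<Longrightarrow> f x \<le> max_value f ?S"
    using min_value_attained[OF _ _ contf] max_value_attained[OF _ _ contf] \<open>x0 \<in> ?S\<close> by blast+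
  have min_iff: "local_minimizer_on f S x0 \<longleftrightarrow> f x0 = min_value f ?S"
  proof
    assume "local_minimizer_on f S x0"
    then have "f x0 \<le> min_value f ?S" using locmin mn(1) by (force simp: le_less)
    then show "f x0 = min_value f ?S" using mn(2)[OF \<open>x0 \<in> ?S\<close>] by simp
  next
    assume "f x0 = min_value f ?S"
    then show "local_minimizer_on f S x0"
      \<comment> \<open>The open ball of radius \<open>R\<close> serves as the neighborhood, since
        the extreme value bounds \<open>f\<close> on all of \<open>?S\<close>.\<close>
      unfolding local_minimizer_on_def
      using mn(2) \<open>R > 0\<close> by (intro exI[of _ "ball x0 R"]) auto
  qed
  have max_iff: "local_maximizer_on f S x0 \<longleftrightarrow> max_value f ?S = f x0"
  proof
    assume "local_maximizer_on f S x0"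
    then have "max_value f ?S \<le> f x0" using locmax mx(1) by (force simp: le_less)
    then show "max_value f ?S = f x0" using mx(2)[OF \<open>x0 \<in> ?S\<close>] by simp
  next
    assume "max_value f ?S = f x0"
    then show "local_maximizer_on f S x0"
      unfolding local_maximizer_on_def
      using mx(2) \<open>R > 0\<close> by (intro exI[of _ "ball x0 R"]) auto
  qed
  have "not_extremum_on f S x0 \<longleftrightarrow> \<not> local_minimizer_on f S x0 \<and> \<not> local_maximizer_on f S x0"
    unfolding not_extremum_on_def local_minimizer_on_def local_maximizer_on_def
    by (meson not_le)
  moreover have "local_minimizer_on f S x0 \<Longrightarrow> f x0 < max_value f ?S"
    using locmin[OF _ p] mx(2)[OF p(1)] by fastforce
  moreover have "local_maximizer_on f S x0 \<Longrightarrow> min_value f ?S < f x0"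
    using locmax[OF _ p] mn(2)[OF p(1)] by fastforce
  moreover have "min_value f ?S \<le> f x0" "f x0 \<le> max_value f ?S"
    using mn(2) mx(2) \<open>x0 \<in> ?S\<close> by blast+
  ultimately show ?thesis
    using min_iff max_iff by (auto simp: less_le)
qed

end
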